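(* Let $\mathcal{G}$ be a finite simple undirected graph whose adjacency matrix has eigenvalues $\lambda_1\ge\dots\ge\lambda_n$ (with multiplicity), so the spectral radius is $\rho=\lambda_1$. Let $\mu=\sum_{i=1}^n\alpha_i\delta_{\lambda_i}$ with $\alpha_i\ge0$, and $m_k=\sum_i\alpha_i\lambda_i^k$. Then for every finite nonempty set $\mathcal{J}$ of positive integers, $$\rho\left(H_{\mathcal{J}}(\mathbf{m})-\alpha_1P_{\mathcal{J}}\right)+\left(S_{\mathcal{J}}(\mathbf{m})-\alpha_1\rho P_{\mathcal{J}}\right)\succeq0,$$ where $H_{\mathcal{J}}(\mathbf{m})=(m_{a+b-2})_{a,b\in\mathcal{J}}$, $S_{\mathcal{J}}(\mathbf{m})=(m_{a+b-1})_{a,b\in\mathcal{J}}$ and $P_{\mathcal{J}}=(\rho^{a+b-2})_{a,b\in\mathcal{J}}$.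
   Context: $\delta_a$ is the Dirac measure at $a$; $M\succeq0$ means positive semidefinite. *)

theory Defs
  imports "Graph_Theory.Digraph" "Jordan_Normal_Form.Spectral_Radius"
begin

(* Finite simple undirected graphs are the locale "graph" of Graph_Theory: finite, loop-free
   symmetric digraphs without parallel arcs, each undirected edge being a pair of opposite arcs.
   The list vs is an enumeration of the vertices, fixing the order of rows and columns. *)
definition adjacency_mat :: "('a, 'b) pre_digraph \<Rightarrow> 'a list \<Rightarrow> real mat" where
  "adjacency_mat G vs =
     mat (length vs) (length vs) (\<lambda>(i, j). if vs ! i \<rightarrow>\<^bsub>G\<^esub> vs ! j then 1 else 0)"

(* The matrix (f a b) with a, b in J, for finite J; rows and columns follow the increasing
   order of J. *)
definition indexed_mat :: "nat set \<Rightarrow> (nat \<Rightarrow> nat \<Rightarrow> real) \<Rightarrow> real mat" where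
  "indexed_mat J f =
     mat (card J) (card J)
       (\<lambda>(i, j). f (sorted_list_of_set J ! i) (sorted_list_of_set J ! j))"

(* In the next three definitions J consists of positive integers, so the subtractions on nat
   do not truncate. *)
definition H_mat :: "nat set \<Rightarrow> (nat \<Rightarrow> real) \<Rightarrow> real mat" where
  "H_mat J m = indexed_mat J (\<lambda>a b. m (a + b - 2))"

definition S_mat :: "nat set \<Rightarrow> (nat \<Rightarrow> real) \<Rightarrow> real mat" where
  "S_mat J m = indexed_mat J (\<lambda>a b. m (a + b - 1))"

definition P_mat :: "nat set \<Rightarrow> real \<Rightarrow> real mat" where
  "P_mat J \<rho> = indexed_mat J (\<lambda>a b. \<rho> ^ (a + b - 2))"

definition psd_mat :: "real mat \<Rightarrow> bool" where
  "psd_mat M \<longleftrightarrow>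
     square_mat M \<and> transpose_mat M = M \<and>
     (\<forall>v \<in> carrier_vec (dim_row M). 0 \<le> v \<bullet> (M *\<^sub>v v))"

end

theory Submission
  imports Defs "Jordan_Normal_Form.Schur_Decomposition"
begin

(* The closed walks of length k are counted by the trace of the k-th power of the adjacency
   matrix, so all power sums of the eigenvalues are nonnegative.  If some eigenvalue were smaller
   than minus the largest one, it would make the high odd power sums negative; hence the largest
   eigenvalue is the spectral radius.  The matrix in question then has the quadratic form
   v |-> sum over i >= 2 of alpha_i (rho + lambda_i) (sum over a in J of lambda_i^(a-1) v_a)^2,
   the terms for i = 1 being cancelled by the multiples of P. *)

section \<open>Traces of matrix powers as power sums of eigenvalues\<close>

definition mat_trace :: "'a::comm_ring_1 mat \<Rightarrow> 'a" where
  "mat_trace A = (\<Sum>i<dim_row A. A $$ (i, i))"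

lemma mat_trace_mult_commute:
  assumes A: "A \<in> carrier_mat n m" and B: "B \<in> carrier_mat m n"
  shows "mat_trace (A * B) = mat_trace (B * A)"
proof -
  have "mat_trace (A * B) = (\<Sum>i<n. \<Sum>j<m. A $$ (i, j) * B $$ (j, i))"
    using A B by (auto simp: mat_trace_def scalar_prod_def atLeast0LessThan intro!: sum.cong)
  also have "\<dots> = (\<Sum>j<m. \<Sum>i<n. B $$ (j, i) * A $$ (i, j))"
    by (subst sum.swap) (simp add: mult.commute)
  also have "\<dots> = mat_trace (B * A)"
    using A B by (auto simp: mat_trace_def scalar_prod_def atLeast0LessThan intro!: sum.cong)
  finally show ?thesis .
qed

text \<open>With \<open>A = P * B * Q\<close>, cyclicity of the trace brings \<open>Q\<close> to the
  front, where it cancels against \<open>P\<close>.\<close>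

lemma mat_trace_similar:
  assumes "similar_mat_wit A B P Q"
  shows "mat_trace A = mat_trace B"
proof -
  define n where "n = dim_row A"
  note wit = similar_mat_witD[OF n_def assms]
  have "mat_trace A = mat_trace (Q * (P * B))"
    unfolding wit(3) using wit by (intro mat_trace_mult_commute[of _ n n]) auto
  also have "Q * (P * B) = B"
    using wit by (simp flip: assoc_mult_mat[of Q n n P n B n])
  finally show ?thesis .
qed

lemma upper_triangular_mult:
  fixes A B :: "'a::comm_ring_1 mat"
  assumes A: "A \<in> carrier_mat n n" "upper_triangular A"
    and B: "B \<in> carrier_mat n n" "upper_triangular B"
  shows "upper_triangular (A * B)"
    and "i < n \<Longrightarrow> (A * B) $$ (i, i) = A $$ (i, i) * B $$ (i, i)"
proof -
  \<comment> \<open>A nonzero summand requires \<open>i\<close> \<le> \<open>k\<close> from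
    \<open>A\<close> and \<open>k\<close> \<le> \<open>j\<close> from \<open>B\<close>. The range
    \<open>{i..j}\<close> is empty below the diagonal and a single index on it, which yields both
    claims.\<close>
  have entry: "(A * B) $$ (i, j) = (\<Sum>k\<in>{i..j}. A $$ (i, k) * B $$ (k, j))"
    if "i < n" "j < n" for i j
  proof -
    have "(A * B) $$ (i, j) = (\<Sum>k<n. A $$ (i, k) * B $$ (k, j))"
      using A B that by (simp add: scalar_prod_def atLeast0LessThan)
    also have "\<dots> = (\<Sum>k\<in>{i..j}. A $$ (i, k) * B $$ (k, j))"
    proof (rule sum.mono_neutral_right)
      show "\<forall>k\<in>{..<n} - {i..j}. A $$ (i, k) * B $$ (k, j) = 0"
        using A B that by (auto simp: upper_triangular_def)
    qed (use that in auto)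
    finally show ?thesis .
  qed
  show "upper_triangular (A * B)"
    using A B by (intro upper_triangularI) (simp add: entry del: index_mult_mat(1))
  show "i < n \<Longrightarrow> (A * B) $$ (i, i) = A $$ (i, i) * B $$ (i, i)"
    by (simp add: entry)
qed

lemma upper_triangular_pow:
  fixes A :: "'a::comm_ring_1 mat"
  assumes A: "A \<in> carrier_mat n n" "upper_triangular A"
  shows "upper_triangular (A ^\<^sub>m k)
    \<and> (\<forall>i<n. (A ^\<^sub>m k) $$ (i, i) = (A $$ (i, i)) ^ k)"
proof (induction k)
  case 0
  show ?case using A by (auto simp: upper_triangular_def)
next
  case (Suc k)
  then show ?case
    using A upper_triangular_mult[of "A ^\<^sub>m k" n A] by (simp add: mult.commute)
qed

text \<open>Since the characteristic polynomial splits, the Schur decomposition makes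
  \<open>A\<close> similar to an upper triangular matrix with diagonal \<open>es\<close>. Similarity
  passes to powers, and powers of a triangular matrix act entrywise on its diagonal.\<close>

lemma mat_trace_pow_eigenvalues:
  fixes A :: "'a::conjugatable_ordered_field mat"
  assumes A: "A \<in> carrier_mat n n" and cp: "char_poly A = (\<Prod>e\<leftarrow>es. [:- e, 1:])"
  shows "mat_trace (A ^\<^sub>m k) = (\<Sum>e\<leftarrow>es. e ^ k)"
proof -
  obtain B P Q where "schur_decomposition A es = (B, P, Q)"
    by (cases "schur_decomposition A es")
  from schur_decomposition[OF A cp this]
  have sim: "similar_mat_wit A B P Q" and ut: "upper_triangular B" and diag: "diag_mat B = es"
    by auto
  have B: "B \<in> carrier_mat n n"
    using similar_mat_witD2[OF A sim] by auto
  have "mat_trace (A ^\<^sub>m k) = mat_trace (B ^\<^sub>m k)"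
    by (rule mat_trace_similar[OF similar_mat_wit_pow[OF sim]])
  also have "\<dots> = (\<Sum>i<n. (B $$ (i, i)) ^ k)"
    using upper_triangular_pow[OF B ut, of k] B by (simp add: mat_trace_def)
  also have "\<dots> = (\<Sum>e\<leftarrow>diag_mat B. e ^ k)"
    using B by (simp add: diag_mat_def sum_list_distinct_conv_sum_set o_def atLeast0LessThan)
  finally show ?thesis using diag by simp
qed

section \<open>Nonnegative power sums and the largest eigenvalue\<close>

lemma nonneg_mat_pow:
  fixes A :: "'a::linordered_idom mat"
  assumes A: "A \<in> carrier_mat n n" and nonneg: "\<And>i j. i < n \<Longrightarrow> j < n \<Longrightarrow> 0 \<le> A $$ (i, j)"
    and "i < n" "j < n"
  shows "0 \<le> (A ^\<^sub>m k) $$ (i, j)"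
  using \<open>i < n\<close> \<open>j < n\<close>
proof (induction k arbitrary: i j)
  case 0
  then show ?case using A by simp
next
  case (Suc k)
  then show ?case
    using A nonneg by (auto simp: scalar_prod_def intro!: sum_nonneg)
qed

lemma neg_le_of_nonneg_power_sums:
  fixes f :: "'i \<Rightarrow> real"
  assumes fin: "finite I" and ub: "\<And>i. i \<in> I \<Longrightarrow> f i \<le> a"
    and nonneg: "\<And>k. 0 \<le> (\<Sum>i\<in>I. f i ^ k)" and j: "j \<in> I"
  shows "- a \<le> f j"
proof (rule ccontr)
  assume "\<not> - a \<le> f j"
  define b where "b = - f j"
  \<comment> \<open>Truncating at 0 covers negative \<open>a\<close>: the ratio \<open>c / b\<close>
    then always lies in [0, 1), so its powers tend to 0.\<close>
  define c where "c = max 0 a"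
  have b: "0 < b" "c < b" and c: "0 \<le> c" "\<And>i. i \<in> I \<Longrightarrow> f i \<le> c"
    using \<open>\<not> - a \<le> f j\<close> ub[OF j] ub by (fastforce simp: b_def c_def)+
  have "(\<lambda>k. real (card I) * (c / b) ^ k) \<longlonglongrightarrow> real (card I) * 0"
    using b c by (intro tendsto_intros) auto
  then have "\<forall>\<^sub>F k in sequentially. real (card I) * (c / b) ^ k < 1"
    by (intro order_tendstoD) auto
  then obtain N where N: "\<And>k. k \<ge> N \<Longrightarrow> real (card I) * (c / b) ^ k < 1"
    by (auto simp: eventually_sequentially)
  \<comment> \<open>An odd exponent keeps \<open>f j ^ k\<close> negative and makes the power
    monotone on all reals, so the upper bound \<open>c\<close> suffices even for negative
    \<open>f i\<close>.\<close>
  define k where "k = 2 * N + 1"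
  have "odd k" and "k \<ge> N"
    by (auto simp: k_def)
  have le: "f i ^ k \<le> c ^ k" if "i \<in> I" for i
    using \<open>odd k\<close> c that by (simp add: power_mono_odd)
  have "(\<Sum>i\<in>I. f i ^ k) = f j ^ k + (\<Sum>i\<in>I - {j}. f i ^ k)"
    using fin j by (simp add: sum.remove)
  also have "\<dots> \<le> - (b ^ k) + (\<Sum>i\<in>I - {j}. c ^ k)"
    using \<open>odd k\<close> le by (intro add_mono sum_mono) (auto simp: b_def)
  \<comment> \<open>Putting \<open>j\<close> back produces the factor \<open>card I\<close>, so that
    the choice of \<open>N\<close>, multiplied by \<open>b ^ k\<close>, applies.\<close>
  also have "\<dots> \<le> - (b ^ k) + (\<Sum>i\<in>I. c ^ k)"
    using fin c by (intro add_left_mono sum_mono2) auto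
  also have "\<dots> < 0"
    using N[OF \<open>k \<ge> N\<close>] b by (simp add: power_divide field_simps)
  finally show False
    using nonneg[of k] by simp
qed

text \<open>A fragment of Perron-Frobenius theory obtained from traces: powers of a nonnegative
  matrix have nonnegative trace, so every power sum of the eigenvalues is nonnegative.\<close>

lemma abs_eigenvalue_le_of_nonneg_mat:
  fixes A :: "real mat" and ev :: "nat \<Rightarrow> real"
  assumes A: "A \<in> carrier_mat n n" and nonneg: "\<And>i j. i < n \<Longrightarrow> j < n \<Longrightarrow> 0 \<le> A $$ (i, j)"
    and cp: "char_poly A = (\<Prod>i = 1..N. [:- ev i, 1:])"
    and ub: "\<And>i. i \<in> {1..N} \<Longrightarrow> ev i \<le> a" and j: "j \<in> {1..N}"
  shows "\<bar>ev j\<bar> \<le> a"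
proof -
  have cp': "char_poly A = (\<Prod>e\<leftarrow>map ev [1..<Suc N]. [:- e, 1:])"
    unfolding cp by (simp add: prod.distinct_set_conv_list[symmetric] o_def
      atLeastLessThanSuc_atLeastAtMost del: upt_Suc)
  have "0 \<le> (\<Sum>i\<in>{1..N}. ev i ^ k)" for k
  proof -
    have "0 \<le> mat_trace (A ^\<^sub>m k)"
      using A nonneg_mat_pow[OF A nonneg] by (auto simp: mat_trace_def intro!: sum_nonneg)
    also have "\<dots> = (\<Sum>i\<in>{1..N}. ev i ^ k)"
      by (simp add: mat_trace_pow_eigenvalues[OF A cp'] o_def sum_list_distinct_conv_sum_set
        atLeastLessThanSuc_atLeastAtMost del: upt_Suc)
    finally show ?thesis .
  qed
  from neg_le_of_nonneg_power_sums[OF _ ub this j] ub[OF j] show ?thesis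
    by simp
qed

text \<open>The embedding into the complex numbers carries the linear factors of the characteristic
  polynomial over, so the complex spectrum consists of the real numbers \<open>ev i\<close>, whose
  norms are their absolute values.\<close>

lemma spectral_radius_of_real_mat:
  fixes A :: "real mat" and ev :: "'i \<Rightarrow> real"
  assumes A: "A \<in> carrier_mat n n" and I: "finite I"
    and cp: "char_poly A = (\<Prod>i\<in>I. [:- ev i, 1:])"
  shows "spectral_radius (map_mat complex_of_real A) = Max ((\<lambda>i. \<bar>ev i\<bar>) ` I)"
proof -
  interpret of_real: map_poly_inj_idom_hom complex_of_real ..
  have "char_poly (map_mat complex_of_real A) = (\<Prod>i\<in>I. [:- complex_of_real (ev i), 1:])"
    by (simp add: of_real_hom.char_poly_hom[OF A] cp of_real.hom_prod)
  then have "spectrum (map_mat complex_of_real A) = (\<lambda>i. complex_of_real (ev i)) ` I"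
    using A I by (auto simp: spectrum_root_char_poly[of _ n] poly_prod)
  then show ?thesis
    by (simp add: spectral_radius_def image_image)
qed

section \<open>Positive semidefiniteness from weighted squares\<close>

lemma quadratic_form_indexed_mat:
  fixes f :: "nat \<Rightarrow> nat \<Rightarrow> real"
  assumes v: "v \<in> carrier_vec (card J)"
  shows "v \<bullet> (indexed_mat J f *\<^sub>v v) =
    (\<Sum>i<card J. \<Sum>j<card J.
      f (sorted_list_of_set J ! i) (sorted_list_of_set J ! j) * v $ i * v $ j)"
  using v by (auto simp: indexed_mat_def scalar_prod_def sum_distrib_left atLeast0LessThan mult_ac
      intro!: sum.cong)

text \<open>Each \<open>i\<close> contributes a rank-one matrix with weight \<open>w i\<close>.
  Moving the sum over \<open>i\<close> outermost lets the double sum over \<open>p\<close> and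
  \<open>q\<close> factor into a square.\<close>

lemma psd_indexed_mat_sum_squares:
  fixes g :: "'i \<Rightarrow> nat \<Rightarrow> real"
  assumes w: "\<And>i. i \<in> I \<Longrightarrow> 0 \<le> w i"
  shows "psd_mat (indexed_mat J (\<lambda>a b. \<Sum>i\<in>I. w i * (g i a * g i b)))"
  unfolding psd_mat_def
proof (intro conjI ballI)
  let ?M = "indexed_mat J (\<lambda>a b. \<Sum>i\<in>I. w i * (g i a * g i b))"
  show "square_mat ?M"
    by (simp add: indexed_mat_def)
  show "transpose_mat ?M = ?M"
    by (rule eq_matI) (auto simp: indexed_mat_def mult.commute)
  fix v :: "real vec"
  assume "v \<in> carrier_vec (dim_row ?M)"
  then have v: "v \<in> carrier_vec (card J)"
    by (simp add: indexed_mat_def)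
  let ?s = "\<lambda>p. sorted_list_of_set J ! p"
  have "v \<bullet> (?M *\<^sub>v v) =
      (\<Sum>p<card J. \<Sum>q<card J. \<Sum>i\<in>I. w i * ((g i (?s p) * v $ p) * (g i (?s q) * v $ q)))"
    by (simp add: quadratic_form_indexed_mat[OF v] sum_distrib_left
        sum_distrib_right mult_ac)
  also have "\<dots> = (\<Sum>p<card J. \<Sum>i\<in>I. \<Sum>q<card J.
      w i * ((g i (?s p) * v $ p) * (g i (?s q) * v $ q)))"
    by (intro sum.cong refl sum.swap)
  also have "\<dots> = (\<Sum>i\<in>I. \<Sum>p<card J. \<Sum>q<card J.
      w i * ((g i (?s p) * v $ p) * (g i (?s q) * v $ q)))"
    by (rule sum.swap)
  also have "\<dots> = (\<Sum>i\<in>I. w i * (\<Sum>p<card J. g i (?s p) * v $ p)\<^sup>2)"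
    by (simp only: power2_eq_square sum_product) (simp only: sum_distrib_left)
  also have "\<dots> \<ge> 0"
    using w by (intro sum_nonneg) simp
  finally show "0 \<le> v \<bullet> (?M *\<^sub>v v)" .
qed

theorem theorem22:
  fixes G :: "('a, 'b) pre_digraph" and vs :: "'a list" and n :: nat
    and ev \<alpha> m :: "nat \<Rightarrow> real" and \<rho> :: real and J :: "nat set"
  assumes "graph G"
    and "distinct vs" and "set vs = verts G" and "n = card (verts G)" and "n \<ge> 1"
    and "char_poly (adjacency_mat G vs) = (\<Prod>i = 1..n. [:- ev i, 1:])"
    and "\<And>i j. 1 \<le> i \<Longrightarrow> i \<le> j \<Longrightarrow> j \<le> n \<Longrightarrow> ev j \<le> ev i"
    and "\<rho> = spectral_radius (map_mat complex_of_real (adjacency_mat G vs))"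
    and "\<And>i. 1 \<le> i \<Longrightarrow> i \<le> n \<Longrightarrow> 0 \<le> \<alpha> i"
    and "\<And>k. m k = (\<Sum>i = 1..n. \<alpha> i * ev i ^ k)"
    and "finite J" and "J \<noteq> {}" and "\<And>j. j \<in> J \<Longrightarrow> 0 < j"
  shows "\<rho> = ev 1 \<and>
    psd_mat (\<rho> \<cdot>\<^sub>m (H_mat J m - \<alpha> 1 \<cdot>\<^sub>m P_mat J \<rho>) + (S_mat J m - (\<alpha> 1 * \<rho>) \<cdot>\<^sub>m P_mat J \<rho>))"
proof -
  let ?A = "adjacency_mat G vs"
  have A: "?A \<in> carrier_mat (length vs) (length vs)"
    by (simp add: adjacency_mat_def)
  have nonneg: "0 \<le> ?A $$ (i, j)" if "i < length vs" "j < length vs" for i j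
    using that by (simp add: adjacency_mat_def)
  have ub: "ev i \<le> ev 1" if "i \<in> {1..n}" for i
    using assms(7)[of 1 i] that by simp
  have abs_le: "\<bar>ev i\<bar> \<le> ev 1" if "i \<in> {1..n}" for i
    by (rule abs_eigenvalue_le_of_nonneg_mat[OF A nonneg assms(6) ub that])
  have "Max ((\<lambda>i. \<bar>ev i\<bar>) ` {1..n}) = ev 1"
  proof (rule Max_eqI)
    \<comment> \<open>The bound at index 1 itself forces \<open>ev 1\<close> to be nonnegative, so
      the maximum is attained there.\<close>
    have "ev 1 = \<bar>ev 1\<bar>"
      using abs_le[of 1] \<open>n \<ge> 1\<close> by simp
    then show "ev 1 \<in> (\<lambda>i. \<bar>ev i\<bar>) ` {1..n}"
      using \<open>n \<ge> 1\<close> by (intro image_eqI[of _ _ 1]) auto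
  qed (use abs_le in auto)
  then have \<rho>: "\<rho> = ev 1"
    using assms(8) by (simp add: spectral_radius_of_real_mat[OF A _ assms(6)])
  have split_1: "m k = \<alpha> 1 * \<rho> ^ k + (\<Sum>i = 2..n. \<alpha> i * ev i ^ k)" for k
    using assms(10) \<open>n \<ge> 1\<close> by (simp add: \<rho> sum.atLeast_Suc_atMost numeral_2_eq_2)
  \<comment> \<open>The exponent \<open>a + b - 2\<close> splits as
    \<open>(a - 1) + (b - 1)\<close>, which gives the product form; \<open>S_mat\<close> has one
    further factor \<open>ev i\<close>, hence the weight \<open>\<rho> + ev i\<close>.\<close>
  have "\<rho> \<cdot>\<^sub>m (H_mat J m - \<alpha> 1 \<cdot>\<^sub>m P_mat J \<rho>) + (S_mat J m - (\<alpha> 1 * \<rho>) \<cdot>\<^sub>m P_mat J \<rho>) =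
      indexed_mat J (\<lambda>a b. \<Sum>i = 2..n. (\<alpha> i * (\<rho> + ev i)) * (ev i ^ (a - 1) * ev i ^ (b - 1)))"
    (is "?L = ?R")
  proof (rule eq_matI)
    fix p q
    assume "p < dim_row ?R" "q < dim_col ?R"
    then have pq: "p < card J" "q < card J"
      by (auto simp: indexed_mat_def)
    \<comment> \<open>Shifting the positive indices down by one turns the exponents
      \<open>a + b - 2\<close> and \<open>a + b - 1\<close> into \<open>a + b\<close> and
      \<open>Suc (a + b)\<close>, free of truncated subtraction.\<close>
    define a where "a = sorted_list_of_set J ! p - 1"
    define b where "b = sorted_list_of_set J ! q - 1"
    have "sorted_list_of_set J ! r \<in> J" if "r < card J" for r
      using nth_mem[of r "sorted_list_of_set J"] that \<open>finite J\<close> by simp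
    then have ab: "sorted_list_of_set J ! p = Suc a" "sorted_list_of_set J ! q = Suc b"
      using assms(13) pq by (simp_all add: a_def b_def)
    have "?L $$ (p, q) =
        \<rho> * (m (a + b) - \<alpha> 1 * \<rho> ^ (a + b)) + (m (Suc (a + b)) - \<alpha> 1 * \<rho> * \<rho> ^ (a + b))"
      using pq by (simp add: H_mat_def S_mat_def P_mat_def indexed_mat_def ab)
    \<comment> \<open>By \<open>split_1\<close>, the term of index 1 cancels separately in each of
      the two brackets.\<close>
    also have "\<dots> = (\<Sum>i = 2..n. \<rho> * (\<alpha> i * ev i ^ (a + b)) + \<alpha> i * ev i ^ Suc (a + b))"
      by (simp add: split_1 sum.distrib sum_distrib_left)
    also have "\<dots> = ?R $$ (p, q)"
      using pq by (simp add: indexed_mat_def ab power_add algebra_simps)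
    finally show "?L $$ (p, q) = ?R $$ (p, q)" .
  qed (simp_all add: H_mat_def S_mat_def P_mat_def indexed_mat_def)
  also have "psd_mat \<dots>"
  proof (rule psd_indexed_mat_sum_squares)
    fix i
    assume "i \<in> {2..n}"
    \<comment> \<open>Here the lower half of \<open>abs_le\<close> is used: \<open>ev i\<close> is
      at least \<open>- \<rho>\<close>.\<close>
    then show "0 \<le> \<alpha> i * (\<rho> + ev i)"
      using assms(9)[of i] abs_le[of i] by (simp add: \<rho> abs_le_iff)
  qed
  finally show ?thesis
    using \<rho> by simp
qed

end
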